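(* Let $I=(\mathcal{E},D,c,f)$ be a CMP instance whose objective $f$ is of type sum, product, or bottleneck, and let $E=\{e_1,\dots,e_k\}\subseteq\mathcal{E}$ be an arbitrary subset. Then: (a) $\bar u'_I(E)\le \min_{l=1}^k u'_I(e_l)$. (b) If $f$ is of type sum or bottleneck, then $\bar u'_I(E)=\min_{l=1}^k u'_I(e_l)$. (c) If $f$ is of type product, then $$\left(\sqrt[k]{\min_{l=1}^k\left\{\frac{u'_I(e_l)}{c(e_l)}\right\}+1}-1\right)\cdot \min_{l=1}^k c(e_l)\;\le\;\bar u'_I(E).$$
   Context: A combinatorial minimization problem (CMP) instance is $I=(\mathcal{E},D,c,f)$ where $\mathcal{E}$ is a finite ground set, $D\subseteq 2^{\mathcal{E}}\setminus\{\emptyset\}$ is a nonempty set of feasible solutions, $c:\mathcal{E}\to\mathbb{R}$ is a cost function, and $f:D\to\mathbb{R}$ is of one of three types: sum, $f(S)=\sum_{a\in S}c(a)$; product, $f(S)=\prod_{a\in S}c(a)$, where for this type all costs are positive; bottleneck, $f(S)=\max_{a\in S}c(a)$. An optimal solution is an $S^*\in D$ minimizing $f$; $D^*$ denotes the set of optimal solutions. For $E=\{e_1,\dots,e_k\}\subseteq\mathcal{E}$ and $\vec\alpha=(\alpha_1,\dots,\alpha_k)\in\mathbb{R}^k$, $I_{\vec\alpha,E}$ is the instance $(\mathcal{E},D,c_{\vec\alpha,E},f_{\vec\alpha,E})$ with costs $c_{\vec\alpha,E}(e_l)=c(e_l)+\alpha_l$ and $c_{\vec\alpha,E}(a)=c(a)$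 for $a\notin E$, and objective of the same type as $f$ computed with these costs; for a single element write $I_{\alpha,e}$. Tolerances take values in $\mathbb{R}\cup\{\infty\}$; $\sup$ of an unbounded set and $\inf\emptyset$ are $\infty$. Single upper tolerance (for any $e\in\mathcal{E}$): $u'_I(e)=\sup\{\alpha\in\mathbb{R}_{\ge0}\mid \text{every } S^*\in D^* \text{ is optimal for } I_{\alpha,e}\}$. Reverse set upper tolerance (for any $E=\{e_1,\dots,e_k\}\subseteq\mathcal{E}$): $\bar u'_I(E)=\inf\{\alpha\in\mathbb{R}\mid \text{there exist } S^*\in D^* \text{ and } \alpha_1,\dots,\alpha_k\ge0 \text{ with } \sum_{l=1}^k\alpha_l=\alpha \text{ such that } S^* \text{ is not optimal for } I_{\vec\alpha,E}\}$. *)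

theory Defs
  imports Complex_Main "HOL-Library.Extended_Real"
begin

datatype objective_type = Sum_Objective | Product_Objective | Bottleneck_Objective

text \<open>
  The objective function of an instance is determined by the costs and the type of objective,
  so the type is stored instead of the function.
\<close>

record 'a cmp =
  ground :: "'a set"
  feasible :: "'a set set"
  cost :: "'a \<Rightarrow> real"
  objective_type :: objective_type

definition cmp_instance :: "'a cmp \<Rightarrow> bool" where
  "cmp_instance I \<longleftrightarrow>
     finite (ground I) \<and>
     feasible I \<subseteq> Pow (ground I) - {{}} \<and>
     feasible I \<noteq> {} \<and>
     (objective_type I = Product_Objective \<longrightarrow> (\<forall>a\<in>ground I. cost I a > 0))"

definition objective :: "'a cmp \<Rightarrow> 'a set \<Rightarrow> real" where
  "objective I S =
     (case objective_type I of
        Sum_Objective \<Rightarrow> (\<Sum>a\<in>S. cost I a)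
      | Product_Objective \<Rightarrow> (\<Prod>a\<in>S. cost I a)
      | Bottleneck_Objective \<Rightarrow> Max (cost I ` S))"

definition optimal_solutions :: "'a cmp \<Rightarrow> 'a set set" where
  "optimal_solutions I =
     {S \<in> feasible I. \<forall>T\<in>feasible I. objective I S \<le> objective I T}"

text \<open>
  A vector $(\alpha_1,\dots,\alpha_k)$ of cost changes of $E = \{e_1,\dots,e_k\}$ is a function
  on elements, of which only the values on \<open>E\<close> matter.
\<close>

definition perturb :: "'a cmp \<Rightarrow> ('a \<Rightarrow> real) \<Rightarrow> 'a set \<Rightarrow> 'a cmp" where
  "perturb I \<alpha> E = I\<lparr>cost := (\<lambda>a. if a \<in> E then cost I a + \<alpha> a else cost I a)\<rparr>"

definition upper_tolerance :: "'a cmp \<Rightarrow> 'a \<Rightarrow> ereal" where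
  "upper_tolerance I e =
     Sup (ereal ` {\<alpha>. 0 \<le> \<alpha> \<and>
       (\<forall>S\<in>optimal_solutions I. S \<in> optimal_solutions (perturb I (\<lambda>_. \<alpha>) {e}))})"

definition reverse_set_upper_tolerance :: "'a cmp \<Rightarrow> 'a set \<Rightarrow> ereal" where
  "reverse_set_upper_tolerance I E =
     Inf (ereal ` {\<alpha>. \<exists>S\<in>optimal_solutions I. \<exists>\<beta>.
       (\<forall>e\<in>E. 0 \<le> \<beta> e) \<and> (\<Sum>e\<in>E. \<beta> e) = \<alpha> \<and> S \<notin> optimal_solutions (perturb I \<beta> E)})"

text \<open>The real \<open>k\<close>-th root, extended to infinite arguments by its limits (for \<open>k > 0\<close>).\<close>

definition ereal_root :: "nat \<Rightarrow> ereal \<Rightarrow> ereal" where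
  "ereal_root k x = (case x of ereal r \<Rightarrow> ereal (root k r) | PInfty \<Rightarrow> \<infinity> | MInfty \<Rightarrow> -\<infinity>)"

end

theory Submission
  imports Defs
begin

text \<open>
  If increases \<open>\<beta>\<close> on \<open>E\<close> of total \<open>\<alpha>\<close> destroy the optimality of an optimal solution \<open>S\<close> because
  of some \<open>T\<close>, then a responsible element \<open>e \<in> (S - T) \<inter> E\<close> exists, and raising \<open>e\<close> alone leaves
  \<open>T\<close> unchanged. For sums and bottlenecks, raising \<open>e\<close> alone by \<open>\<alpha>\<close> already makes \<open>S\<close> worse
  than \<open>T\<close>. For products, \<open>u'(e) / c(e) + 1 \<le> f(T) / f(S)\<close>, whereas \<open>f(T) / f(S)\<close> is less than
  the product of the factors \<open>1 + \<beta>(a) / c(a)\<close> over \<open>a \<in> (S - T) \<inter> E\<close>; these are at most \<open>k\<close>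
  factors, each of them at most \<open>1 + \<alpha> / min c\<close>.
\<close>

section \<open>Perturbed instances, feasible and optimal sets\<close>

lemma cost_perturb: "cost (perturb I \<beta> E) a = (if a \<in> E then cost I a + \<beta> a else cost I a)"
  by (simp add: perturb_def)

lemma feasible_perturb [simp]: "feasible (perturb I \<beta> E) = feasible I"
  by (simp add: perturb_def)

lemma objective_type_perturb [simp]: "objective_type (perturb I \<beta> E) = objective_type I"
  by (simp add: perturb_def)

lemma objective_cong:
  assumes "objective_type I = objective_type J" "\<And>a. a \<in> S \<Longrightarrow> cost I a = cost J a"
  shows "objective I S = objective J S"
proof -
  have "cost I ` S = cost J ` S" using assms(2) by (intro image_cong) auto
  then show ?thesis
    using assms by (auto simp: objective_def split: objective_type.split intro: sum.cong prod.cong)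
qed

lemma objective_perturb_singleton_notin:
  assumes "e \<notin> T"
  shows "objective (perturb I (\<lambda>_. \<alpha>) {e}) T = objective I T"
  using assms by (intro objective_cong) (auto simp: cost_perturb)

lemma optimal_solutions_feasible: "S \<in> optimal_solutions I \<Longrightarrow> S \<in> feasible I"
  by (simp add: optimal_solutions_def)

lemma optimal_solutionsD:
  "S \<in> optimal_solutions I \<Longrightarrow> T \<in> feasible I \<Longrightarrow> objective I S \<le> objective I T"
  by (simp add: optimal_solutions_def)

lemma not_optimal_perturbE:
  assumes "S \<in> feasible I" "S \<notin> optimal_solutions (perturb I \<beta> E)"
  obtains T where "T \<in> feasible I"
    "objective (perturb I \<beta> E) T < objective (perturb I \<beta> E) S"
  using assms by (auto simp: optimal_solutions_def not_le)

lemma feasible_subset_ground: "cmp_instance I \<Longrightarrow> S \<in> feasible I \<Longrightarrow> S \<subseteq> ground I"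
  by (auto simp: cmp_instance_def)

lemma feasible_nonempty: "cmp_instance I \<Longrightarrow> S \<in> feasible I \<Longrightarrow> S \<noteq> {}"
  by (auto simp: cmp_instance_def)

lemma feasible_finite: "cmp_instance I \<Longrightarrow> S \<in> feasible I \<Longrightarrow> finite S"
  using feasible_subset_ground by (metis cmp_instance_def finite_subset)

section \<open>Elementary bounds on the two tolerances\<close>

lemma upper_tolerance_nonneg: "0 \<le> upper_tolerance I e"
proof -
  have "cost (perturb I (\<lambda>_. 0) {e}) = cost I" by (auto simp: cost_perturb)
  then have "objective (perturb I (\<lambda>_. 0) {e}) = objective I"
    by (intro ext objective_cong) simp_all
  then have "optimal_solutions (perturb I (\<lambda>_. 0) {e}) = optimal_solutions I"
    by (simp add: optimal_solutions_def)
  \<comment> \<open>The change 0 lies in the set under the supremum, which is therefore not empty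
    and cannot have supremum \<open>-\<infinity>\<close>.\<close>
  then have "ereal 0 \<le> upper_tolerance I e"
    unfolding upper_tolerance_def by (intro Sup_upper imageI) auto
  then show ?thesis by (simp add: zero_ereal_def)
qed

text \<open>Since \<open>e\<close> is outside \<open>T\<close>, raising \<open>e\<close> leaves the
  value of \<open>T\<close> fixed. Hence \<open>T\<close> beats \<open>S\<close> for every
  \<open>x > \<alpha>\<close>, and no such \<open>x\<close> enters the supremum.\<close>

lemma upper_tolerance_le:
  assumes "S \<in> optimal_solutions I" "T \<in> feasible I" "e \<notin> T"
    and "\<And>x. x > \<alpha> \<Longrightarrow> objective I T < objective (perturb I (\<lambda>_. x) {e}) S"
  shows "upper_tolerance I e \<le> ereal \<alpha>"
  unfolding upper_tolerance_def
proof (rule Sup_least, clarify)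
  fix x assume "\<forall>S\<in>optimal_solutions I. S \<in> optimal_solutions (perturb I (\<lambda>_. x) {e})"
  then have "objective (perturb I (\<lambda>_. x) {e}) S \<le> objective (perturb I (\<lambda>_. x) {e}) T"
    using assms(1,2) by (auto intro!: optimal_solutionsD)
  then have "objective (perturb I (\<lambda>_. x) {e}) S \<le> objective I T"
    using assms(3) by (simp add: objective_perturb_singleton_notin)
  then show "ereal x \<le> ereal \<alpha>" using assms(4)[of x] by force
qed

lemma reverse_set_upper_tolerance_geI:
  assumes "\<And>S \<beta>. S \<in> optimal_solutions I \<Longrightarrow> (\<And>e. e \<in> E \<Longrightarrow> 0 \<le> \<beta> e) \<Longrightarrow>
    S \<notin> optimal_solutions (perturb I \<beta> E) \<Longrightarrow> x \<le> ereal (\<Sum>e\<in>E. \<beta> e)"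
  shows "x \<le> reverse_set_upper_tolerance I E"
  unfolding reverse_set_upper_tolerance_def using assms by (intro Inf_greatest) blast

text \<open>Raising \<open>e\<close> alone is a special change vector on \<open>E\<close>, so every
  real number above the tolerance of \<open>e\<close> takes part in the infimum. This gives
  (a).\<close>

lemma reverse_set_upper_tolerance_le_upper_tolerance:
  assumes "finite E" "e \<in> E"
  shows "reverse_set_upper_tolerance I E \<le> upper_tolerance I e"
proof (rule dense_ge)
  fix y assume y: "upper_tolerance I e < y"
  show "reverse_set_upper_tolerance I E \<le> y"
  proof (cases y)
    case (real \<alpha>)
    have "0 \<le> \<alpha>" using upper_tolerance_nonneg[of I e] y real
      by (metis ereal_less_eq(5) less_imp_le order.trans)
    have "\<not> (\<forall>S\<in>optimal_solutions I. S \<in> optimal_solutions (perturb I (\<lambda>_. \<alpha>) {e}))"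
    proof
      assume "\<forall>S\<in>optimal_solutions I. S \<in> optimal_solutions (perturb I (\<lambda>_. \<alpha>) {e})"
      then have "ereal \<alpha> \<le> upper_tolerance I e"
        unfolding upper_tolerance_def using \<open>0 \<le> \<alpha>\<close> by (intro Sup_upper imageI) auto
      then show False using y real by simp
    qed
    then obtain S where S: "S \<in> optimal_solutions I"
      "S \<notin> optimal_solutions (perturb I (\<lambda>_. \<alpha>) {e})" by blast
    \<comment> \<open>The whole increase goes to \<open>e\<close>, so the total over
      \<open>E\<close> is \<open>\<alpha>\<close> and the perturbed instance is the single-element
      one.\<close>
    let ?\<beta> = "\<lambda>a. if a = e then \<alpha> else 0"
    have "perturb I ?\<beta> E = perturb I (\<lambda>_. \<alpha>) {e}"
      using \<open>e \<in> E\<close> unfolding perturb_def by (intro arg_cong[where f = "\<lambda>c. I\<lparr>cost := c\<rparr>"]) auto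
    moreover have "(\<Sum>a\<in>E. ?\<beta> a) = \<alpha>" using assms by simp
    ultimately have "reverse_set_upper_tolerance I E \<le> ereal \<alpha>"
      unfolding reverse_set_upper_tolerance_def using S \<open>0 \<le> \<alpha>\<close>
      by (intro Inf_lower imageI CollectI bexI[of _ S] exI[of _ ?\<beta>]) auto
    then show ?thesis using real by simp
  qed (use y in auto)
qed

section \<open>Bounds on a single tolerance from one competitor \<open>T\<close>\<close>

lemma upper_tolerance_le_sum:
  assumes I: "cmp_instance I" "objective_type I = Sum_Objective"
    and S: "S \<in> optimal_solutions I" and T: "T \<in> feasible I" and e: "e \<in> S - T"
  shows "upper_tolerance I e \<le> ereal (objective I T - objective I S)"
proof (rule upper_tolerance_le[OF S T])
  fix x assume "x > objective I T - objective I S"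
  have "finite S" using I S by (auto intro: feasible_finite optimal_solutions_feasible)
  have "objective (perturb I (\<lambda>_. x) {e}) S = (\<Sum>a\<in>S. cost I a + (if a = e then x else 0))"
    using I(2) by (auto simp: objective_def cost_perturb intro: sum.cong)
  also have "\<dots> = objective I S + x"
    using I(2) e \<open>finite S\<close> by (simp add: sum.distrib objective_def)
  finally show "objective I T < objective (perturb I (\<lambda>_. x) {e}) S"
    using \<open>x > _\<close> by simp
qed (use e in auto)

text \<open>The raised cost of \<open>e\<close> alone already exceeds the value of \<open>T\<close>.
  The difference is taken to \<open>cost I e\<close> and not to the value of \<open>S\<close>,
  because \<open>e\<close> need not attain the maximum over \<open>S\<close>.\<close>

lemma upper_tolerance_le_bottleneck:
  assumes I: "cmp_instance I" "objective_type I = Bottleneck_Objective"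
    and S: "S \<in> optimal_solutions I" and T: "T \<in> feasible I" and e: "e \<in> S - T"
  shows "upper_tolerance I e \<le> ereal (objective I T - cost I e)"
proof (rule upper_tolerance_le[OF S T])
  fix x assume x: "x > objective I T - cost I e"
  have "finite S" using I S by (auto intro: feasible_finite optimal_solutions_feasible)
  then have "cost (perturb I (\<lambda>_. x) {e}) e \<le> objective (perturb I (\<lambda>_. x) {e}) S"
    using I(2) e by (simp add: objective_def)
  then show "objective I T < objective (perturb I (\<lambda>_. x) {e}) S"
    using x by (simp add: cost_perturb)
qed (use e in auto)

lemma objective_product_pos:
  assumes "cmp_instance I" "objective_type I = Product_Objective" "S \<in> feasible I"
  shows "objective I S > 0"
proof -
  have "\<And>a. a \<in> S \<Longrightarrow> cost I a > 0"
    using assms feasible_subset_ground[OF assms(1,3)] by (auto simp: cmp_instance_def)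
  then show ?thesis using assms(2) by (simp add: objective_def prod_pos)
qed

text \<open>Costs are positive, so an additive increase is a factor
  \<open>1 + \<beta> a / cost I a\<close>. This makes products accessible to the cancellation used
  for sums.\<close>

lemma objective_perturb_product:
  assumes I: "cmp_instance I" "objective_type I = Product_Objective" and S: "S \<in> feasible I"
  shows "objective (perturb I \<beta> E) S =
    objective I S * (\<Prod>a\<in>S. if a \<in> E then 1 + \<beta> a / cost I a else 1)"
proof -
  have "cost I a \<noteq> 0" if "a \<in> S" for a
    using that I feasible_subset_ground[OF I(1) S] by (force simp: cmp_instance_def)
  then have "objective (perturb I \<beta> E) S =
    (\<Prod>a\<in>S. cost I a * (if a \<in> E then 1 + \<beta> a / cost I a else 1))"
    using I(2) by (auto simp: objective_def cost_perturb field_simps intro!: prod.cong)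
  then show ?thesis using I(2) by (simp add: prod.distrib objective_def)
qed

text \<open>The bound is the increase at which the factor \<open>1 + x / cost I e\<close> of
  \<open>S\<close> reaches the ratio of the values of \<open>T\<close> and \<open>S\<close>.\<close>

lemma upper_tolerance_le_product:
  assumes I: "cmp_instance I" "objective_type I = Product_Objective"
    and S: "S \<in> optimal_solutions I" and T: "T \<in> feasible I" and e: "e \<in> S - T"
  shows "upper_tolerance I e \<le> ereal (cost I e * (objective I T / objective I S - 1))"
proof (rule upper_tolerance_le[OF S T])
  fix x assume x: "x > cost I e * (objective I T / objective I S - 1)"
  have Sf: "S \<in> feasible I" using S by (rule optimal_solutions_feasible)
  have "finite S" using I Sf by (auto intro: feasible_finite)
  have c: "cost I e > 0"
    using e I feasible_subset_ground[OF I(1) Sf] by (auto simp: cmp_instance_def)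
  have pos: "objective I S > 0" using I Sf by (rule objective_product_pos)
  have "(\<Prod>a\<in>S. if a \<in> {e} then 1 + x / cost I a else 1) = 1 + x / cost I e"
    using e \<open>finite S\<close> by (simp add: prod.delta)
  then have "objective (perturb I (\<lambda>_. x) {e}) S = objective I S * (1 + x / cost I e)"
    using objective_perturb_product[OF I Sf, of "\<lambda>_. x" "{e}"] by simp
  moreover have "objective I T / objective I S - 1 < x / cost I e"
    using x c by (simp add: pos_less_divide_eq mult.commute)
  then have "objective I T < objective I S * (1 + x / cost I e)"
    using pos by (simp add: field_simps)
  ultimately show "objective I T < objective (perturb I (\<lambda>_. x) {e}) S" by simp
qed (use e in auto)

section \<open>From a change that destroys optimality to a responsible element\<close>

lemma ex_upper_tolerance_le_sum:
  assumes I: "cmp_instance I" "objective_type I = Sum_Objective" and "finite E"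
    and S: "S \<in> optimal_solutions I" and \<beta>: "\<And>e. e \<in> E \<Longrightarrow> 0 \<le> \<beta> e"
    and nopt: "S \<notin> optimal_solutions (perturb I \<beta> E)"
  shows "\<exists>e\<in>E. upper_tolerance I e \<le> ereal (\<Sum>e\<in>E. \<beta> e)"
proof -
  have Sf: "S \<in> feasible I" using S by (rule optimal_solutions_feasible)
  from Sf nopt obtain T where T: "T \<in> feasible I"
    and less: "objective (perturb I \<beta> E) T < objective (perturb I \<beta> E) S"
    by (rule not_optimal_perturbE)
  let ?b = "\<lambda>a. if a \<in> E then \<beta> a else 0"
  have fin: "finite S" "finite T" using I Sf T by (auto intro: feasible_finite)
  have pert: "objective (perturb I \<beta> E) X = objective I X + sum ?b X" for X
    using I(2) by (auto simp: objective_def cost_perturb sum.distrib[symmetric] intro: sum.cong)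
  have split: "sum ?b X = sum ?b (X \<inter> Y) + sum ?b (X - Y)" if "finite X" for X Y
    using that by (rule sum.Int_Diff)
  \<comment> \<open>The increases on \<open>S \<inter> T\<close> cancel, and those on
    \<open>T - S\<close> only help \<open>S\<close>. So the increases on \<open>S - T\<close> alone
    must exceed the gap.\<close>
  have "0 \<le> sum ?b (T - S)" using \<beta> by (intro sum_nonneg) auto
  then have gap: "objective I T - objective I S < sum ?b (S - T)"
    using less split[OF fin(1), of T] split[OF fin(2), of S] by (simp add: pert Int_commute)
  have b_eq: "sum ?b (S - T) = sum \<beta> ((S - T) \<inter> E)"
    using fin by (simp add: sum.inter_restrict)
  \<comment> \<open>Optimality of \<open>S\<close> makes the gap nonnegative, so the sum exceeding
    it is positive and cannot be empty.\<close>
  have "(S - T) \<inter> E \<noteq> {}"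
    using gap optimal_solutionsD[OF S T] by (auto simp: b_eq)
  then obtain e where e: "e \<in> S - T" "e \<in> E" by blast
  have "sum \<beta> ((S - T) \<inter> E) \<le> sum \<beta> E" using \<open>finite E\<close> \<beta> by (intro sum_mono2) auto
  then have "ereal (objective I T - objective I S) \<le> ereal (sum \<beta> E)" using gap b_eq by simp
  then show ?thesis using upper_tolerance_le_sum[OF I S T e(1)] e(2) by (meson order.trans)
qed

lemma ex_upper_tolerance_le_bottleneck:
  assumes I: "cmp_instance I" "objective_type I = Bottleneck_Objective" and "finite E"
    and S: "S \<in> optimal_solutions I" and \<beta>: "\<And>e. e \<in> E \<Longrightarrow> 0 \<le> \<beta> e"
    and nopt: "S \<notin> optimal_solutions (perturb I \<beta> E)"
  shows "\<exists>e\<in>E. upper_tolerance I e \<le> ereal (\<Sum>e\<in>E. \<beta> e)"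
proof -
  have Sf: "S \<in> feasible I" using S by (rule optimal_solutions_feasible)
  from Sf nopt obtain T where T: "T \<in> feasible I"
    and less: "objective (perturb I \<beta> E) T < objective (perturb I \<beta> E) S"
    by (rule not_optimal_perturbE)
  have fin: "finite S" "finite T" using I Sf T by (auto intro: feasible_finite)
  have ne: "S \<noteq> {}" "T \<noteq> {}" using I Sf T by (auto dest: feasible_nonempty)
  let ?c = "cost (perturb I \<beta> E)"
  have "Max (?c ` S) \<in> ?c ` S" using fin ne by (intro Max_in) auto
  then obtain e where e: "e \<in> S" "objective (perturb I \<beta> E) S = ?c e"
    using I(2) by (auto simp: objective_def)
  have T_mono: "objective I T \<le> objective (perturb I \<beta> E) T"
  proof -
    have "cost I a \<le> Max (?c ` T)" if "a \<in> T" for a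
    proof -
      have "cost I a \<le> ?c a" using \<beta> by (simp add: cost_perturb)
      also have "\<dots> \<le> Max (?c ` T)" using that fin by simp
      finally show ?thesis .
    qed
    then show ?thesis using I(2) fin ne by (auto simp: objective_def)
  qed
  have "cost I e \<le> objective I S" using I(2) e(1) fin by (simp add: objective_def)
  \<comment> \<open>Otherwise the new value of \<open>S\<close> would be the old cost of
    \<open>e\<close>, which is at most the old value of \<open>S\<close>, hence at most the old and
    the new value of \<open>T\<close>.\<close>
  then have "e \<in> E"
    using less e(2) T_mono optimal_solutionsD[OF S T] by (auto simp: cost_perturb split: if_splits)
  have "?c e \<le> objective (perturb I \<beta> E) T" if "e \<in> T"
    using that I(2) fin by (simp add: objective_def)
  then have "e \<in> S - T" using less e by force
  have "objective I T - cost I e \<le> \<beta> e"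
    using less e(2) T_mono \<open>e \<in> E\<close> by (simp add: cost_perturb)
  also have "\<beta> e \<le> sum \<beta> E" using \<open>finite E\<close> \<open>e \<in> E\<close> \<beta> by (intro member_le_sum) auto
  finally have "ereal (objective I T - cost I e) \<le> ereal (sum \<beta> E)" by simp
  then show ?thesis
    using upper_tolerance_le_bottleneck[OF I S T \<open>e \<in> S - T\<close>] \<open>e \<in> E\<close> by (meson order.trans)
qed

text \<open>Here the total increase does not bound the tolerance directly, since several factors
  compound. \<open>m\<close> is any positive lower bound on the costs in \<open>E\<close>, later
  their minimum.\<close>

lemma ex_upper_tolerance_le_product:
  assumes I: "cmp_instance I" "objective_type I = Product_Objective" and E: "E \<subseteq> ground I"
    and m: "0 < m" "\<And>e. e \<in> E \<Longrightarrow> m \<le> cost I e"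
    and S: "S \<in> optimal_solutions I" and \<beta>: "\<And>e. e \<in> E \<Longrightarrow> 0 \<le> \<beta> e"
    and nopt: "S \<notin> optimal_solutions (perturb I \<beta> E)"
  shows "\<exists>e\<in>E. upper_tolerance I e \<le> ereal (cost I e * ((1 + (\<Sum>e\<in>E. \<beta> e) / m) ^ card E - 1))"
proof -
  have Sf: "S \<in> feasible I" using S by (rule optimal_solutions_feasible)
  from Sf nopt obtain T where T: "T \<in> feasible I"
    and less: "objective (perturb I \<beta> E) T < objective (perturb I \<beta> E) S"
    by (rule not_optimal_perturbE)
  have fin: "finite S" "finite T" using I Sf T by (auto intro: feasible_finite)
  have "finite E" using E I(1) by (auto simp: cmp_instance_def intro: finite_subset)
  have cpos: "cost I a > 0" if "a \<in> E" for a using that m by force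
  let ?q = "\<lambda>a. if a \<in> E then 1 + \<beta> a / cost I a else 1"
  have q1: "1 \<le> ?q a" for a using \<beta> cpos by (simp add: less_imp_le)
  have qpos: "0 < prod ?q X" for X using q1 by (intro prod_pos) (meson less_le_trans zero_less_one)
  have split: "prod ?q X = prod ?q (X \<inter> Y) * prod ?q (X - Y)" if "finite X" for X Y
    using that by (rule prod.Int_Diff)
  have pos: "objective I S > 0" "objective I T > 0"
    using I Sf T by (auto intro: objective_product_pos)
  \<comment> \<open>The common factor over \<open>S \<inter> T\<close> is kept on both sides until
    it cancels. The factor over \<open>T - S\<close> is at least 1 and is dropped.\<close>
  have "prod ?q (S \<inter> T) * objective I T \<le> prod ?q (S \<inter> T) * (objective I T * prod ?q (T - S))"
    using pos qpos[of "S \<inter> T"] prod_ge_1[of "T - S" ?q] q1 by (intro mult_left_mono) auto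
  also have "\<dots> < prod ?q (S \<inter> T) * (objective I S * prod ?q (S - T))"
    using less split[OF fin(1), of T] split[OF fin(2), of S]
    by (simp add: objective_perturb_product[OF I Sf] objective_perturb_product[OF I T]
        Int_commute mult_ac)
  finally have "objective I T < objective I S * prod ?q (S - T)"
    using qpos[of "S \<inter> T"] by (simp add: mult_less_cancel_left_pos)
  then have gap: "objective I T / objective I S < prod ?q (S - T)"
    using pos by (simp add: pos_divide_less_eq mult.commute)
  have q_eq: "prod ?q (S - T) = prod (\<lambda>a. 1 + \<beta> a / cost I a) ((S - T) \<inter> E)"
    using fin by (simp add: prod.inter_restrict)
  have "1 \<le> objective I T / objective I S" using pos optimal_solutionsD[OF S T] by simp
  then have "(S - T) \<inter> E \<noteq> {}" using gap by (auto simp: q_eq)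
  then obtain e where e: "e \<in> S - T" "e \<in> E" by blast
  \<comment> \<open>Each factor is at most the base because \<open>\<beta> a\<close> is at most the
    total and \<open>m \<le> cost I a\<close>. As the base is at least 1, the exponent may be raised
    to \<open>card E\<close>.\<close>
  have "prod (\<lambda>a. 1 + \<beta> a / cost I a) ((S - T) \<inter> E) \<le> (1 + sum \<beta> E / m) ^ card E"
  proof (rule prod_le_power)
    fix a assume "a \<in> (S - T) \<inter> E"
    then have a: "a \<in> E" by simp
    have "\<beta> a \<le> sum \<beta> E" using \<open>finite E\<close> a \<beta> by (intro member_le_sum) auto
    then have "\<beta> a / cost I a \<le> sum \<beta> E / m"
      using a m \<beta> by (intro frac_le) (auto intro: sum_nonneg)
    then show "0 \<le> 1 + \<beta> a / cost I a \<and> 1 + \<beta> a / cost I a \<le> 1 + sum \<beta> E / m"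
      using a \<beta> cpos by (simp add: add_nonneg_nonneg less_imp_le)
  next
    show "card ((S - T) \<inter> E) \<le> card E" using \<open>finite E\<close> by (intro card_mono) auto
    show "1 \<le> 1 + sum \<beta> E / m" using m \<beta> by (simp add: sum_nonneg)
  qed
  then have "objective I T / objective I S - 1 \<le> (1 + sum \<beta> E / m) ^ card E - 1"
    using gap q_eq by linarith
  then have "ereal (cost I e * (objective I T / objective I S - 1))
      \<le> ereal (cost I e * ((1 + sum \<beta> E / m) ^ card E - 1))"
    using cpos[OF e(2)] by (simp add: mult_left_mono)
  then show ?thesis using upper_tolerance_le_product[OF I S T e(1)] e(2) by (meson order.trans)
qed

theorem theorem2:
  fixes I :: "'a cmp" and E :: "'a set"
  assumes "cmp_instance I"
    and "E \<subseteq> ground I"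
  shows "reverse_set_upper_tolerance I E \<le> (INF e\<in>E. upper_tolerance I e)
    \<and> (objective_type I = Sum_Objective \<or> objective_type I = Bottleneck_Objective \<longrightarrow>
         reverse_set_upper_tolerance I E = (INF e\<in>E. upper_tolerance I e))
    \<and> (objective_type I = Product_Objective \<longrightarrow>
         (ereal_root (card E) ((INF e\<in>E. upper_tolerance I e / ereal (cost I e)) + 1) - 1)
           * (INF e\<in>E. ereal (cost I e))
         \<le> reverse_set_upper_tolerance I E)"
proof (intro conjI impI)
  have finE: "finite E" using assms by (auto simp: cmp_instance_def intro: finite_subset)
  show upper: "reverse_set_upper_tolerance I E \<le> (INF e\<in>E. upper_tolerance I e)"
    using finE by (intro INF_greatest reverse_set_upper_tolerance_le_upper_tolerance)
  {
    assume "objective_type I = Sum_Objective \<or> objective_type I = Bottleneck_Objective"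
    \<comment> \<open>Some element of \<open>E\<close> has a tolerance at most the total of the
      destructive change, and the infimum over \<open>E\<close> lies below that tolerance.\<close>
    then have "(INF e\<in>E. upper_tolerance I e) \<le> reverse_set_upper_tolerance I E"
      using ex_upper_tolerance_le_sum[OF assms(1) _ finE]
        ex_upper_tolerance_le_bottleneck[OF assms(1) _ finE]
      by (intro reverse_set_upper_tolerance_geI) (meson INF_lower2)
    with upper show "reverse_set_upper_tolerance I E = (INF e\<in>E. upper_tolerance I e)"
      by (rule antisym)
  }
  assume prod: "objective_type I = Product_Objective"
  let ?m = "INF e\<in>E. upper_tolerance I e / ereal (cost I e)"
  show "(ereal_root (card E) (?m + 1) - 1) * (INF e\<in>E. ereal (cost I e))
    \<le> reverse_set_upper_tolerance I E"
  proof (rule reverse_set_upper_tolerance_geI)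
    fix S \<beta>
    assume S: "S \<in> optimal_solutions I" and \<beta>: "\<And>e. e \<in> E \<Longrightarrow> 0 \<le> \<beta> e"
      and nopt: "S \<notin> optimal_solutions (perturb I \<beta> E)"
    \<comment> \<open>With \<open>E\<close> empty no optimality can be lost. Hence the degree
      \<open>card E\<close> of the root is positive and the minimum cost exists.\<close>
    have "E \<noteq> {}"
    proof
      assume "E = {}"
      then have "perturb I \<beta> E = I" by (simp add: perturb_def)
      then show False using S nopt by simp
    qed
    define c where "c = Min (cost I ` E)"
    have cpos: "cost I e > 0" if "e \<in> E" for e
      using that assms prod by (auto simp: cmp_instance_def)
    have c: "0 < c" "\<And>e. e \<in> E \<Longrightarrow> c \<le> cost I e"
      using finE \<open>E \<noteq> {}\<close> cpos by (auto simp: c_def)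
    have "c \<in> cost I ` E" unfolding c_def using finE \<open>E \<noteq> {}\<close> by (intro Min_in) auto
    then have INF_cost: "(INF e\<in>E. ereal (cost I e)) = ereal c"
      using c(2) by (intro antisym INF_greatest) (auto intro: INF_lower2)
    define b where "b = (\<Sum>e\<in>E. \<beta> e)"
    have "0 \<le> b" using \<beta> by (simp add: b_def sum_nonneg)
    obtain e where e: "e \<in> E"
      "upper_tolerance I e \<le> ereal (cost I e * ((1 + b / c) ^ card E - 1))"
      using ex_upper_tolerance_le_product[OF assms(1) prod assms(2) c S \<beta> nopt]
      by (auto simp: b_def)
    \<comment> \<open>Division by \<open>cost I e\<close> leaves a bound that no longer depends on
      \<open>e\<close>, so it also bounds the minimum of the quotients.\<close>
    have "upper_tolerance I e / ereal (cost I e) \<le> ereal ((1 + b / c) ^ card E - 1)"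
      using e cpos[OF e(1)] by (simp add: ereal_divide_le_pos)
    then have m_le: "?m \<le> ereal ((1 + b / c) ^ card E - 1)" using e(1) by (intro INF_lower2)
    \<comment> \<open>Together with the finite upper bound this excludes both infinite values, so
      the extended root is the real one.\<close>
    have "0 \<le> ?m"
      using upper_tolerance_nonneg less_imp_le[OF cpos]
      by (intro INF_greatest zero_le_divide_ereal) simp_all
    with m_le obtain r where r: "?m = ereal r" by (cases ?m) auto
    \<comment> \<open>The root is monotone and undoes the power, as \<open>1 + b / c\<close> is
      nonnegative. Solving for \<open>b\<close> gives (c).\<close>
    have "root (card E) (r + 1) \<le> root (card E) ((1 + b / c) ^ card E)"
      using m_le r finE \<open>E \<noteq> {}\<close> by (simp add: card_gt_0_iff)
    also have "\<dots> = 1 + b / c"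
      using \<open>0 \<le> b\<close> c(1) finE \<open>E \<noteq> {}\<close> by (intro real_root_power_cancel) (auto simp: card_gt_0_iff)
    finally have "(root (card E) (r + 1) - 1) * c \<le> b"
      using c(1) by (simp add: field_simps)
    then show "(ereal_root (card E) (?m + 1) - 1) * (INF e\<in>E. ereal (cost I e))
        \<le> ereal (\<Sum>e\<in>E. \<beta> e)"
      unfolding r INF_cost by (simp add: ereal_root_def one_ereal_def b_def)
  qed
qed

end
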